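(* Let $K\subseteq\mathbb{R}^n$ be a closed set, $h:\mathbb{R}^n\to\mathbb{R}\cup\{\pm\infty\}$ a proper lower semicontinuous function such that $K\subseteq\operatorname{dom}h$, $\beta>0$, and $z\in K$. Suppose that $\overline{x}\in\operatorname{argmin}_K h$, that $K$ is star-shaped at $\overline{x}$, and that $h$ is strongly star quasiconvex on $K$ with modulus $\gamma>0$. If $x^*\in\operatorname{Prox}_{\beta h}(K,z)$, then $$\frac{\gamma}{2}\|x^*-\overline{x}\|^2\le\frac{1}{\beta}\langle x^*-z,\overline{x}-x^*\rangle.$$
   Context: $h$ is proper if $\operatorname{dom}h:=\{x: h(x)<+\infty\}\ne\emptyset$ and $h>-\infty$ everywhere. $K$ is star-shaped at $\overline{x}\in K$ if $[\overline{x},x]\subseteq K$ for every $x\in K$. $h$ is strongly star quasiconvex on $K$ with modulus $\gamma>0$ if, with $\overline{x}\in\operatorname{argmin}_K h$ (the minimizer over $K$, then unique), for every $y\in K$ and $\lambda\in[0,1]$, $$h(\lambda\overline{x}+(1-\lambda)y)\le h(y)-\lambda(1-\lambda)\frac{\gamma}{2}\|y-\overline{x}\|^2.$$ $\operatorname{Prox}_{\beta h}(K,z):=\operatorname{argmin}_{y\in K}\{h(y)+\frac{1}{2\beta}\|y-z\|^2\}$ (set-valued). *)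

theory Defs
  imports "HOL-Analysis.Analysis"
begin

definition effective_dom :: "('a \<Rightarrow> ereal) \<Rightarrow> 'a set" where
  "effective_dom h = {x. h x < \<infinity>}"

definition proper_fun :: "('a \<Rightarrow> ereal) \<Rightarrow> bool" where
  "proper_fun h \<longleftrightarrow> effective_dom h \<noteq> {} \<and> (\<forall>x. h x > -\<infinity>)"

definition lower_semicontinuous :: "('a::topological_space \<Rightarrow> ereal) \<Rightarrow> bool" where
  "lower_semicontinuous h \<longleftrightarrow> (\<forall>x. h x \<le> Liminf (at x) h)"

definition argmin_on :: "'a set \<Rightarrow> ('a \<Rightarrow> ereal) \<Rightarrow> 'a set" where
  "argmin_on K h = {x. is_arg_min h (\<lambda>y. y \<in> K) x}"

definition star_shaped_at :: "'a::real_vector set \<Rightarrow> 'a \<Rightarrow> bool" where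
  "star_shaped_at K a \<longleftrightarrow> a \<in> K \<and> (\<forall>x\<in>K. closed_segment a x \<subseteq> K)"

(* If K is star-shaped at some minimizer b of h over K and h is real-valued on K, then the
   witness a below equals b: otherwise the inequality with y = b and t = 1/2 would give a point
   of the segment [b,a], hence of K, where h is smaller than h b. So in that setting a is the
   unique minimizer, and the inequality holds at every (i.e. the only) minimizer. *)
definition strongly_star_quasiconvex_on ::
    "'a::real_normed_vector set \<Rightarrow> ('a \<Rightarrow> ereal) \<Rightarrow> real \<Rightarrow> bool" where
  "strongly_star_quasiconvex_on K h \<gamma> \<longleftrightarrow>
     \<gamma> > 0 \<and>
     (\<exists>a\<in>argmin_on K h. \<forall>y\<in>K. \<forall>t\<in>{0..1}.
        h (t *\<^sub>R a + (1 - t) *\<^sub>R y)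
          \<le> h y - ereal (t * (1 - t) * (\<gamma> / 2) * (norm (y - a))\<^sup>2))"

definition Prox :: "real \<Rightarrow> ('a::real_normed_vector \<Rightarrow> ereal) \<Rightarrow> 'a set \<Rightarrow> 'a \<Rightarrow> 'a set" where
  "Prox \<beta> h K z = argmin_on K (\<lambda>y. h y + ereal (1 / (2 * \<beta>) * (norm (y - z))\<^sup>2))"

end

theory Submission
  imports Defs
begin

text \<open>Comparing the proximal point \<open>x\<^sup>*\<close> with the points \<open>t a + (1 - t) x\<^sup>*\<close> of the
  segment to the minimizer \<open>a\<close> and using strong star quasiconvexity there bounds
  \<open>t (1 - t) \<gamma>/2 \<parallel>x\<^sup>* - a\<parallel>\<^sup>2\<close> by the increment of \<open>\<parallel>\<cdot> - z\<parallel>\<^sup>2 / (2 \<beta>)\<close>; expand the square,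
  divide by \<open>t\<close>, and let \<open>t\<close> tend to \<open>0\<close>.\<close>

text \<open>Serves for the final passage t -> 0; the bound is available only for t in (0,1), hence
  the one-sided limit.\<close>

lemma le_of_le_add_mult_small:
  fixes A B C :: real
  assumes "\<And>t. 0 < t \<Longrightarrow> t < 1 \<Longrightarrow> A \<le> B + t * C"
  shows "A \<le> B"
proof (rule tendsto_lowerbound)
  show "((\<lambda>t. B + t * C) \<longlongrightarrow> B) (at_right 0)"
    by (auto intro!: tendsto_eq_intros)
  show "\<forall>\<^sub>F t in at_right 0. A \<le> B + t * C"
    using assms by (auto simp: eventually_at_right_field intro!: exI[of _ 1])
qed simp

lemma argmin_onD:
  assumes "x \<in> argmin_on K h"
  shows "x \<in> K" and "\<And>y. y \<in> K \<Longrightarrow> h x \<le> h y"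
  using assms by (auto simp: argmin_on_def is_arg_min_def not_less)

text \<open>The definition grants the inequality only at some minimizer \<open>a\<close>, while the
  theorem fixes its own. A midpoint argument forces \<open>a = b\<close>, so the inequality
  transfers.\<close>

lemma strongly_star_quasiconvex_on_argmin:
  assumes qc: "strongly_star_quasiconvex_on K h \<gamma>"
    and min: "b \<in> argmin_on K h"
    and star: "star_shaped_at K b"
    and finite: "\<bar>h b\<bar> \<noteq> \<infinity>"
    and "y \<in> K" "t \<in> {0..1}"
  shows "h (t *\<^sub>R b + (1 - t) *\<^sub>R y) \<le> h y - ereal (t * (1 - t) * (\<gamma> / 2) * (norm (y - b))\<^sup>2)"
proof -
  obtain a where "\<gamma> > 0" and a: "a \<in> argmin_on K h"
    and ineq: "\<And>y t. y \<in> K \<Longrightarrow> t \<in> {0..1} \<Longrightarrow>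
      h (t *\<^sub>R a + (1 - t) *\<^sub>R y) \<le> h y - ereal (t * (1 - t) * (\<gamma> / 2) * (norm (y - a))\<^sup>2)"
    using qc unfolding strongly_star_quasiconvex_on_def by blast
  let ?m = "(1/2) *\<^sub>R a + (1 - 1/2) *\<^sub>R b"
  have "?m \<in> closed_segment b a"
    unfolding closed_segment_def by (intro CollectI exI[of _ "1/2"]) (simp add: add.commute)
  then have "?m \<in> K"
    using star argmin_onD(1)[OF a] by (auto simp: star_shaped_at_def)
  \<comment> \<open>Minimality of \<open>b\<close> bounds \<open>h b\<close> by the value at
    \<open>?m\<close>, which \<open>ineq\<close> with \<open>y = b\<close> bounds in turn. As
    \<open>h b\<close> is finite it cancels, leaving \<gamma>/8 times the squared distance
    nonpositive.\<close>
  then have "h b \<le> h b - ereal (1/2 * (1 - 1/2) * (\<gamma> / 2) * (norm (b - a))\<^sup>2)"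
    using argmin_onD(2)[OF min] ineq[OF argmin_onD(1)[OF min], of "1/2"] by fastforce
  then have "\<gamma> * (norm (b - a))\<^sup>2 \<le> 0"
    using finite by (cases "h b") auto
  then have "a = b"
    using \<open>\<gamma> > 0\<close> by (simp add: mult_le_0_iff)
  then show ?thesis
    using ineq assms by simp
qed

theorem proposition26:
  fixes K :: "(real ^ 'n) set"
    and h :: "real ^ 'n \<Rightarrow> ereal"
    and \<beta> \<gamma> :: real
    and z xbar xstar :: "real ^ 'n"
  assumes "closed K"
    and "proper_fun h"
    and "lower_semicontinuous h"
    and "K \<subseteq> effective_dom h"
    and "\<beta> > 0"
    and "z \<in> K"
    and "xbar \<in> argmin_on K h"
    and "star_shaped_at K xbar"
    and "\<gamma> > 0"
    and "strongly_star_quasiconvex_on K h \<gamma>"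
    and "xstar \<in> Prox \<beta> h K z"
  shows "\<gamma> / 2 * (norm (xstar - xbar))\<^sup>2 \<le> 1 / \<beta> * ((xstar - z) \<bullet> (xbar - xstar))"
proof -
  have real_valued: "\<bar>h x\<bar> \<noteq> \<infinity>" if "x \<in> K" for x
    using assms(2,4) that by (auto simp: proper_fun_def effective_dom_def)
  have xbar: "xbar \<in> K" and xstar: "xstar \<in> K"
    using argmin_onD(1) assms(7,11) by (auto simp: Prox_def)
  let ?D = "(norm (xstar - xbar))\<^sup>2" and ?P = "(xstar - z) \<bullet> (xbar - xstar)"
  show ?thesis
  proof (rule le_of_le_add_mult_small)
    fix t :: real
    assume t: "0 < t" "t < 1"
    let ?y = "t *\<^sub>R xbar + (1 - t) *\<^sub>R xstar"
    \<comment> \<open>The parameter is \<open>1 - t\<close> because \<open>closed_segment\<close>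
      puts its weight on the second endpoint.\<close>
    have "?y \<in> closed_segment xbar xstar"
      using t by (auto simp: closed_segment_def algebra_simps intro!: exI[of _ "1 - t"])
    then have y: "?y \<in> K"
      using assms(8) xstar by (auto simp: star_shaped_at_def)
    have prox: "h xstar + ereal (1 / (2 * \<beta>) * (norm (xstar - z))\<^sup>2)
        \<le> h ?y + ereal (1 / (2 * \<beta>) * (norm (?y - z))\<^sup>2)"
      using argmin_onD(2) assms(11) y unfolding Prox_def by fast
    have qc: "h ?y \<le> h xstar - ereal (t * (1 - t) * (\<gamma> / 2) * ?D)"
      using strongly_star_quasiconvex_on_argmin[OF assms(10,7,8) real_valued[OF xbar] xstar] t by simp
    \<comment> \<open>With both values real, \<open>prox\<close> and \<open>qc\<close> can be added
      and the values of \<open>h\<close> cancel.\<close>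
    obtain r s where "h xstar = ereal r" "h ?y = ereal s"
      using real_valued[OF xstar] real_valued[OF y] by (cases "h xstar"; cases "h ?y") auto
    with prox qc have *: "t * (1 - t) * (\<gamma> / 2) * ?D
        \<le> 1 / (2 * \<beta>) * ((norm (?y - z))\<^sup>2 - (norm (xstar - z))\<^sup>2)"
      by (simp add: right_diff_distrib)
    have "?y - z = (xstar - z) + t *\<^sub>R (xbar - xstar)"
      by (simp add: algebra_simps)
    then have "(norm (?y - z))\<^sup>2 - (norm (xstar - z))\<^sup>2 = t * (2 * ?P + t * ?D)"
      by (simp only: dot_square_norm[symmetric])
         (simp add: inner_simps inner_commute algebra_simps power2_eq_square)
    with * have "t * ((1 - t) * (\<gamma> / 2) * ?D) \<le> t * (1 / (2 * \<beta>) * (2 * ?P + t * ?D))"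
      by (simp add: mult.assoc mult.left_commute)
    then have "(1 - t) * (\<gamma> / 2) * ?D \<le> 1 / (2 * \<beta>) * (2 * ?P + t * ?D)"
      using t by (simp only: mult_le_cancel_left_pos)
    \<comment> \<open>Everything of first order in \<open>t\<close> is moved to the right; its
      coefficient, free of \<open>t\<close>, instantiates the constant \<open>C\<close> of the limit
      lemma.\<close>
    then show "\<gamma> / 2 * ?D \<le> 1 / \<beta> * ?P + t * (?D / (2 * \<beta>) + \<gamma> / 2 * ?D)"
      using \<open>\<beta> > 0\<close> by (simp add: field_simps)
  qed
qed

end
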